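(* Consider the one-dimensional polytropic ($\gamma>1$) or isothermal ($\gamma=1$) Euler system, with state $\mathbf u=(\varrho,\varrho v_1,\varrho v_2,\varrho v_3)^T$, $\varrho>0$, and flux $\mathbf f(\mathbf u)=(\varrho v_1,\ \varrho v_1^2+p,\ \varrho v_1v_2,\ \varrho v_1v_3)^T$. Let the numerical flux at the interface between two cells with states $\mathbf u_L,\mathbf u_R$ be $$\mathbf f^{*,\mathrm{ES}}=\mathbf f^{*,\mathrm{EC}}-\tfrac12\,\hat{\mathsf R}\,|\hat{\mathsf\Lambda}|\,\hat{\mathsf Z}\,\hat{\mathsf R}^T[\![\mathbf w]\!].$$ If $\mathbf f^*=\mathbf f^{*,\mathrm{ES}}$ is used in the discrete entropy update $$\Delta x\,\frac{\partial}{\partial t}(s_L+s_R)=[\![\mathbf w]\!]^T\mathbf f^{*}-[\![\mathbf w^T\mathbf f]\!],$$ then the method dissipates entropy with the correct sign, i.e. $$\Delta x\,\frac{\partial}{\partial t}(s_L+s_R)+[\![f^s]\!]\le 0 .$$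
   Context: Equation of state: either the polytropic case, with constants $\gamma>1$, $\kappa>0$, pressure $p(\varrho)=\kappa\varrho^\gamma$ and internal energy $e(\varrho)=\frac{\kappa\varrho^{\gamma-1}}{\gamma-1}$; or the isothermal case, with $\gamma=1$, a constant $c>0$, $p(\varrho)=c^2\varrho$ and $e(\varrho)=c^2\ln(\varrho)$. States have density $\varrho>0$ and velocity $\vec v=(v_1,v_2,v_3)\in\mathbb R^3$. Entropy function: $s(\mathbf u)=\frac{\varrho}{2}\|\vec v\|^2+\varrho e(\varrho)$. Entropy variables: $\mathbf w=\partial s/\partial\mathbf u=\left(e+\frac{p}{\varrho}-\frac12\|\vec v\|^2,\,v_1,\,v_2,\,v_3\right)^T$. Entropy flux: $f^s=v_1(s+p)$. For a quantity with left and right values $(\cdot)_L,(\cdot)_R$, the jump is $[\![\cdot]\!]=(\cdot)_R-(\cdot)_L$ and the arithmetic mean is $\{\!\{\cdot\}\!\}=\frac12\left((\cdot)_L+(\cdot)_R\right)$. For $\varrho_L\neq\varrho_R$ the $\gamma$-mean of the density and the average square sound speed are $$\{\!\{\varrho\}\!\}_\gamma=\frac1\gamma\frac{[\![p]\!]}{[\![e]\!]},\qquad \overline{a^2}=\frac{[\![p]\!]}{[\![\varrho]\!]};$$ for $\varrho_L=\varrho_R=\varrho$ they are given their limiting values $\{\!\{\varrho\}\!\}_\gamma=\varrho$ and $\overline{a^2}=\gamma p(\varrho)/\varrho$. The discrete entropy update is the semi-discrete entropy evolution obtained by contracting the cell updates $\Delta x\,\partial_t\mathbf u_L=\mathbf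 f_L-\mathbf f^*$ and $\Delta x\,\partial_t\mathbf u_R=\mathbf f^*-\mathbf f_R$ with $\mathbf w_L$ and $\mathbf w_R$ and adding, using $s_t=\mathbf w^T\mathbf u_t$; here $\Delta x>0$ is the uniform cell size, $\mathbf f_{L},\mathbf f_R$ are the physical fluxes at the two states, and $s_L,s_R$ are the entropies of the two states. The baseline flux and matrices are $$\mathbf f^{*,\mathrm{EC}}=\begin{bmatrix}\{\!\{\varrho\}\!\}_\gamma\{\!\{v_1\}\!\}\\ \{\!\{\varrho\}\!\}_\gamma\{\!\{v_1\}\!\}^2+\{\!\{p\}\!\}\\ \{\!\{\varrho\}\!\}_\gamma\{\!\{v_1\}\!\}\{\!\{v_2\}\!\}\\ \{\!\{\varrho\}\!\}_\gamma\{\!\{v_1\}\!\}\{\!\{v_3\}\!\}\end{bmatrix},\qquad \hat{\mathsf R}=\begin{bmatrix}1&0&0&1\\ \{\!\{v_1\}\!\}-\sqrt{\overline{a^2}}&0&0&\{\!\{v_1\}\!\}+\sqrt{\overline{a^2}}\\ \{\!\{v_2\}\!\}&1&0&\{\!\{v_2\}\!\}\\ \{\!\{v_3\}\!\}&0&1&\{\!\{v_3\}\!\}\end{bmatrix},$$ $$\hat{\mathsf Z}=\mathrm{diag}\left(\frac{\{\!\{\varrho\}\!\}_\gamma}{2\overline{a^2}},\ \{\!\{\varrho\}\!\}_\gamma,\ \{\!\{\varrho\}\!\}_\gamma,\ \frac{\{\!\{\varrho\}\!\}_\gamma}{2\overline{a^2}}\right),$$ $$\hat{\mathsf\Lambda}=\mathrm{diag}\left(\{\!\{v_1\}\!\}-\sqrt{\overline{a^2}},\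 \{\!\{v_1\}\!\},\ \{\!\{v_1\}\!\},\ \{\!\{v_1\}\!\}+\sqrt{\overline{a^2}}\right),$$ and $|\hat{\mathsf\Lambda}|$ is the diagonal matrix of the absolute values of the entries of $\hat{\mathsf\Lambda}$. *)

theory Defs
  imports "HOL-Analysis.Analysis"
begin

section \<open>Equation of state\<close>

text \<open>\<open>Polytropic \<gamma> \<kappa>\<close> and \<open>Isothermal c\<close>; the adiabatic exponent of the latter is 1.\<close>

datatype eos = Polytropic real real | Isothermal real

fun admissible :: "eos \<Rightarrow> bool" where
  "admissible (Polytropic \<gamma> \<kappa>) \<longleftrightarrow> \<gamma> > 1 \<and> \<kappa> > 0"
| "admissible (Isothermal c) \<longleftrightarrow> c > 0"

fun adiabatic_exponent :: "eos \<Rightarrow> real" where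
  "adiabatic_exponent (Polytropic \<gamma> \<kappa>) = \<gamma>"
| "adiabatic_exponent (Isothermal c) = 1"

fun pressure_of_density :: "eos \<Rightarrow> real \<Rightarrow> real" where
  "pressure_of_density (Polytropic \<gamma> \<kappa>) \<rho> = \<kappa> * \<rho> powr \<gamma>"
| "pressure_of_density (Isothermal c) \<rho> = c\<^sup>2 * \<rho>"

fun energy_of_density :: "eos \<Rightarrow> real \<Rightarrow> real" where
  "energy_of_density (Polytropic \<gamma> \<kappa>) \<rho> = \<kappa> * \<rho> powr (\<gamma> - 1) / (\<gamma> - 1)"
| "energy_of_density (Isothermal c) \<rho> = c\<^sup>2 * ln \<rho>"


section \<open>States, fluxes and entropy\<close>

text \<open>
  A state is the vector of conserved variables \<open>u = (\<rho>, \<rho> v\<^sub>1, \<rho> v\<^sub>2, \<rho> v\<^sub>3)\<close>, so the velocity is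
  recovered by dividing by the density.  All functions below are meant for \<open>mass_density u > 0\<close>.
\<close>

type_synonym state = "real ^ 4"

definition mass_density :: "state \<Rightarrow> real" where
  "mass_density u = u $ 1"

definition velocity :: "state \<Rightarrow> real ^ 3" where
  "velocity u = (1 / mass_density u) *\<^sub>R vector [u $ 2, u $ 3, u $ 4]"

definition pressure :: "eos \<Rightarrow> state \<Rightarrow> real" where
  "pressure E u = pressure_of_density E (mass_density u)"

definition internal_energy :: "eos \<Rightarrow> state \<Rightarrow> real" where
  "internal_energy E u = energy_of_density E (mass_density u)"

definition flux :: "eos \<Rightarrow> state \<Rightarrow> real ^ 4" where
  "flux E u = (let \<rho> = mass_density u; v = velocity u in
     vector [\<rho> * v $ 1, \<rho> * (v $ 1)\<^sup>2 + pressure E u, \<rho> * v $ 1 * v $ 2, \<rho> * v $ 1 * v $ 3])"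

definition entropy :: "eos \<Rightarrow> state \<Rightarrow> real" where
  "entropy E u = mass_density u / 2 * (norm (velocity u))\<^sup>2 + mass_density u * internal_energy E u"

definition entropy_vars :: "eos \<Rightarrow> state \<Rightarrow> real ^ 4" where
  "entropy_vars E u = (let v = velocity u in
     vector [internal_energy E u + pressure E u / mass_density u - (norm v)\<^sup>2 / 2, v $ 1, v $ 2, v $ 3])"

definition entropy_flux :: "eos \<Rightarrow> state \<Rightarrow> real" where
  "entropy_flux E u = velocity u $ 1 * (entropy E u + pressure E u)"


section \<open>The entropy variables are the gradient of the entropy\<close>

lemma vector_4:
  "(vector [x1,x2,x3,x4] :: ('a::zero)^4) $ 1 = x1"
  "(vector [x1,x2,x3,x4] :: ('a::zero)^4) $ 2 = x2"
  "(vector [x1,x2,x3,x4] :: ('a::zero)^4) $ 3 = x3"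
  "(vector [x1,x2,x3,x4] :: ('a::zero)^4) $ 4 = x4"
  unfolding vector_def by simp_all

lemma energy_deriv:
  assumes "admissible E" "\<rho> > 0"
  shows "((\<lambda>r. r * energy_of_density E r) has_real_derivative
      energy_of_density E \<rho> + pressure_of_density E \<rho> / \<rho>) (at \<rho>)"
proof (cases E)
  case (Polytropic g k)
  have "g > 1" using assms(1) Polytropic by simp
  have "((\<lambda>r. r * (k * r powr (g - 1) / (g - 1))) has_real_derivative
      1 * (k * \<rho> powr (g - 1) / (g - 1)) + (k * ((g - 1) * \<rho> powr (g - 1 - 1)) / (g - 1)) * \<rho>) (at \<rho>)"
    by (intro DERIV_mult DERIV_ident DERIV_cdivide DERIV_cmult has_real_derivative_powr assms(2))
  moreover have "(k * ((g - 1) * \<rho> powr (g - 1 - 1)) / (g - 1)) * \<rho> = k * \<rho> powr g / \<rho>"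
    using \<open>g > 1\<close> assms(2) by (simp add: powr_diff power2_eq_square)
  ultimately show ?thesis using Polytropic by simp
next
  case (Isothermal c)
  then show ?thesis using assms
    by (auto intro!: derivative_eq_intros simp: field_simps power2_eq_square)
qed

lemma norm_vector3_sq: "(norm (vector [a,b,c] :: real^3))\<^sup>2 = a\<^sup>2 + b\<^sup>2 + c\<^sup>2"
  unfolding power2_norm_eq_inner by (simp add: inner_vec_def sum_3 vector_3 power2_eq_square)

lemma entropy_alt:
  "entropy E u = ((u $ 2)\<^sup>2 + (u $ 3)\<^sup>2 + (u $ 4)\<^sup>2) / (2 * u $ 1)
     + u $ 1 * energy_of_density E (u $ 1)"
  by (cases "u $ 1 = 0"; simp add: entropy_def velocity_def mass_density_def internal_energy_def
     power_mult_distrib power_divide norm_vector3_sq; simp add: power2_eq_square field_simps)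

lemma entropy_gradient:
  assumes "admissible E" "mass_density u > 0"
  shows "(entropy E has_derivative (\<lambda>h. entropy_vars E u \<bullet> h)) (at u)"
proof -
  have u1: "u $ 1 > 0" using assms by (simp add: mass_density_def)
  have comp: "((\<lambda>x. x $ i) has_derivative (\<lambda>h. h $ i)) (at u)" for i :: 4
    by (rule bounded_linear.has_derivative[OF bounded_linear_vec_nth has_derivative_ident])
  have en: "((\<lambda>x. x $ 1 * energy_of_density E (x $ 1)) has_derivative
      (\<lambda>h. (energy_of_density E (u$1) + pressure_of_density E (u$1) / u$1) * h $ 1)) (at u)"
    using has_derivative_compose[OF comp[of 1] energy_deriv[OF assms(1) u1, unfolded has_field_derivative_def]]
    by simp
  have vv: "(norm (velocity u))\<^sup>2 = ((u $ 2)\<^sup>2 + (u $ 3)\<^sup>2 + (u $ 4)\<^sup>2) / (u $ 1)\<^sup>2"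
    using u1 by (simp add: velocity_def mass_density_def
      power_mult_distrib power_divide norm_vector3_sq)
  have eq: "entropy E = (\<lambda>u. ((u $ 2)\<^sup>2 + (u $ 3)\<^sup>2 + (u $ 4)\<^sup>2) / (2 * u $ 1) + u $ 1 * energy_of_density E (u $ 1))"
    by (rule ext) (rule entropy_alt)
  have ki: "((\<lambda>u. ((u $ 2)\<^sup>2 + (u $ 3)\<^sup>2 + (u $ 4)\<^sup>2) / (2 * u $ 1)) has_derivative
     (\<lambda>h. - (norm (velocity u))\<^sup>2 / 2 * h $ 1 + (u$2 * h$2 + u$3*h$3 + u$4*h$4) / u$1)) (at u)"
    unfolding vv using u1
    by (auto intro!: derivative_eq_intros comp simp: fun_eq_iff power2_eq_square field_simps)
  show ?thesis unfolding eq
    by (rule has_derivative_eq_rhs[OF has_derivative_add[OF ki en]])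
       (simp add: fun_eq_iff entropy_vars_def Let_def velocity_def[of u] inner_vec_def sum_4 vector_4 vector_3
          internal_energy_def pressure_def mass_density_def algebra_simps add_divide_distrib)
qed


section \<open>Jumps and averages across an interface\<close>

text \<open>
  The first argument is a quantity as a function of the state; the other two are the left and
  the right state.
\<close>

definition jump :: "(state \<Rightarrow> 'a::real_vector) \<Rightarrow> state \<Rightarrow> state \<Rightarrow> 'a" where
  "jump q uL uR = q uR - q uL"

definition mean :: "(state \<Rightarrow> 'a::real_vector) \<Rightarrow> state \<Rightarrow> state \<Rightarrow> 'a" where
  "mean q uL uR = (1 / 2) *\<^sub>R (q uL + q uR)"

definition gamma_mean :: "eos \<Rightarrow> state \<Rightarrow> state \<Rightarrow> real" where
  "gamma_mean E uL uR =
     (if mass_density uL = mass_density uR then mass_density uL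
      else 1 / adiabatic_exponent E * (jump (pressure E) uL uR / jump (internal_energy E) uL uR))"

definition mean_sound_speed_sq :: "eos \<Rightarrow> state \<Rightarrow> state \<Rightarrow> real" where
  "mean_sound_speed_sq E uL uR =
     (if mass_density uL = mass_density uR then adiabatic_exponent E * pressure E uL / mass_density uL
      else jump (pressure E) uL uR / jump mass_density uL uR)"


section \<open>Numerical fluxes\<close>

definition diag :: "real ^ 'n \<Rightarrow> real ^ 'n ^ 'n" where
  "diag d = (\<chi> i j. if i = j then d $ i else 0)"

definition flux_EC :: "eos \<Rightarrow> state \<Rightarrow> state \<Rightarrow> real ^ 4" where
  "flux_EC E uL uR = (let \<rho> = gamma_mean E uL uR; v = mean velocity uL uR in
     vector [\<rho> * v $ 1, \<rho> * (v $ 1)\<^sup>2 + mean (pressure E) uL uR,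
             \<rho> * v $ 1 * v $ 2, \<rho> * v $ 1 * v $ 3])"

definition R_hat :: "eos \<Rightarrow> state \<Rightarrow> state \<Rightarrow> real ^ 4 ^ 4" where
  "R_hat E uL uR = (let v = mean velocity uL uR; a = sqrt (mean_sound_speed_sq E uL uR) in
     vector [vector [1,         0, 0, 1],
             vector [v $ 1 - a, 0, 0, v $ 1 + a],
             vector [v $ 2,     1, 0, v $ 2],
             vector [v $ 3,     0, 1, v $ 3]])"

definition Z_hat :: "eos \<Rightarrow> state \<Rightarrow> state \<Rightarrow> real ^ 4 ^ 4" where
  "Z_hat E uL uR = (let \<rho> = gamma_mean E uL uR; a2 = mean_sound_speed_sq E uL uR in
     diag (vector [\<rho> / (2 * a2), \<rho>, \<rho>, \<rho> / (2 * a2)]))"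

definition lambda_hat :: "eos \<Rightarrow> state \<Rightarrow> state \<Rightarrow> real ^ 4" where
  "lambda_hat E uL uR =
     (let v1 = mean velocity uL uR $ 1; a = sqrt (mean_sound_speed_sq E uL uR) in
     vector [v1 - a, v1, v1, v1 + a])"

definition abs_Lambda_hat :: "eos \<Rightarrow> state \<Rightarrow> state \<Rightarrow> real ^ 4 ^ 4" where
  "abs_Lambda_hat E uL uR = diag (\<chi> i. \<bar>lambda_hat E uL uR $ i\<bar>)"

definition flux_ES :: "eos \<Rightarrow> state \<Rightarrow> state \<Rightarrow> real ^ 4" where
  "flux_ES E uL uR = flux_EC E uL uR - (1 / 2) *\<^sub>R
     ((R_hat E uL uR ** abs_Lambda_hat E uL uR ** Z_hat E uL uR ** transpose (R_hat E uL uR))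
        *v jump (entropy_vars E) uL uR)"

end

theory Submission
  imports Defs
begin

text \<open>
  The entropy-conservative flux satisfies Tadmor's condition \<open>\<lbrakk>w\<rbrakk> \<bullet> f* = \<lbrakk>p v\<^sub>1\<rbrakk>\<close>, where \<open>p v\<^sub>1\<close> is the
  entropy potential \<open>w \<bullet> f - f\<^sup>s\<close>: this works because \<open>\<lbrakk>e + p / \<rho>\<rbrakk> = \<gamma> \<lbrakk>e\<rbrakk>\<close>, so that multiplying by
  the \<open>\<gamma>\<close>-mean of the density gives exactly \<open>\<lbrakk>p\<rbrakk>\<close>.  The additional dissipation is a quadratic form in
  \<open>\<lbrakk>w\<rbrakk>\<close>, nonnegative because \<open>p\<close> and \<open>e\<close> increase with the density.
\<close>

lemma norm_sq_3: "(norm v)\<^sup>2 = (v $ 1)\<^sup>2 + (v $ 2)\<^sup>2 + (v $ 3)\<^sup>2" for v :: "real ^ 3"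
  unfolding power2_norm_eq_inner by (simp add: inner_vec_def sum_3 power2_eq_square)

text \<open>In \<open>w \<bullet> f\<close> the pressure term \<open>p v_1\<close> arises twice,
  from \<open>p / \<rho>\<close> and from the momentum flux; the entropy flux absorbs one copy
  together with all energy terms.\<close>

lemma flux_potential:
  assumes "mass_density u > 0"
  shows "entropy_vars E u \<bullet> flux E u - entropy_flux E u = pressure E u * velocity u $ 1"
  using assms
  by (simp add: entropy_vars_def flux_def entropy_flux_def entropy_def Let_def inner_vec_def
      sum_4 vector_4 norm_sq_3; simp add: field_simps power2_eq_square)

lemma pressure_of_density_strict_mono:
  assumes "admissible E"
  shows "strict_mono_on {0<..} (pressure_of_density E)"
  using assms by (cases E) (auto simp: strict_mono_on_def intro: powr_less_mono2)

lemma energy_of_density_strict_mono: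
  assumes "admissible E"
  shows "strict_mono_on {0<..} (energy_of_density E)"
  using assms by (cases E) (auto simp: strict_mono_on_def intro!: divide_strict_right_mono powr_less_mono2)

text \<open>In the polytropic case \<open>p / \<rho> = (\<gamma> - 1) e\<close>, so the enthalpy
  itself is \<open>\<gamma> e\<close>. In the isothermal case \<open>p / \<rho>\<close> is the
  constant \<open>c\<^sup>2\<close>, which cancels only in the difference; hence the form with
  jumps.\<close>

lemma enthalpy_jump:
  assumes "admissible E" "0 < r" "0 < q"
  shows "energy_of_density E q + pressure_of_density E q / q
       - (energy_of_density E r + pressure_of_density E r / r)
       = adiabatic_exponent E * (energy_of_density E q - energy_of_density E r)"
proof (cases E)
  case (Polytropic g k)
  have "k * x powr (g - 1) / (g - 1) + k * x powr g / x = g * (k * x powr (g - 1) / (g - 1))"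
    if "x > 0" for x
    using that assms(1) Polytropic by (simp add: powr_diff field_simps)
  from this[OF assms(2)] this[OF assms(3)] show ?thesis
    using Polytropic by (simp add: right_diff_distrib)
next
  case (Isothermal c)
  then show ?thesis using assms by (simp add: algebra_simps)
qed

lemma adiabatic_exponent_pos: "admissible E \<Longrightarrow> adiabatic_exponent E > 0"
  by (cases E) auto

lemma pressure_of_density_pos:
  "admissible E \<Longrightarrow> 0 < r \<Longrightarrow> pressure_of_density E r > 0"
  by (cases E) auto

text \<open>Numerator and denominator share their sign. Taking \<open>g\<close> as the energy serves
  the density mean, taking it as the identity serves the sound speed.\<close>

lemma strict_mono_difference_quotient_pos:
  fixes f g :: "real \<Rightarrow> real"
  assumes "strict_mono_on A f" "strict_mono_on A g" "r \<in> A" "q \<in> A" "r \<noteq> q"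
  shows "(f q - f r) / (g q - g r) > 0"
  using assms by (cases "r < q") (auto simp: strict_mono_on_def intro: divide_pos_pos divide_neg_neg)

context
  fixes E uL uR
  assumes adm: "admissible E" and pos: "mass_density uL > 0" "mass_density uR > 0"
begin

lemma gamma_mean_pos: "gamma_mean E uL uR > 0"
proof (cases "mass_density uL = mass_density uR")
  case False
  then have "jump (pressure E) uL uR / jump (internal_energy E) uL uR > 0"
    using strict_mono_difference_quotient_pos[OF pressure_of_density_strict_mono[OF adm]
        energy_of_density_strict_mono[OF adm], of "mass_density uL" "mass_density uR"] pos
    by (simp add: jump_def pressure_def internal_energy_def)
  with False show ?thesis
    using adiabatic_exponent_pos[OF adm]
    by (auto simp: gamma_mean_def zero_less_divide_iff zero_less_mult_iff mult_less_0_iff)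
qed (simp add: gamma_mean_def pos)

lemma mean_sound_speed_sq_pos: "mean_sound_speed_sq E uL uR > 0"
proof (cases "mass_density uL = mass_density uR")
  case False
  then show ?thesis
    using strict_mono_difference_quotient_pos[OF pressure_of_density_strict_mono[OF adm],
        of "\<lambda>x. x" "mass_density uL" "mass_density uR"] pos
    by (simp add: mean_sound_speed_sq_def jump_def pressure_def strict_mono_on_def)
next
  case True
  then show ?thesis
    using adiabatic_exponent_pos[OF adm] pressure_of_density_pos[OF adm] pos
    by (simp add: mean_sound_speed_sq_def pressure_def)
qed

lemma gamma_mean_enthalpy_jump:
  "gamma_mean E uL uR * jump (\<lambda>u. internal_energy E u + pressure E u / mass_density u) uL uR
     = jump (pressure E) uL uR"
proof (cases "mass_density uL = mass_density uR")
  case False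
  \<comment> \<open>The energy jump is the denominator in \<open>gamma_mean\<close>, so it must be
    nonzero before it can be cancelled.\<close>
  then have "energy_of_density E (mass_density uR) \<noteq> energy_of_density E (mass_density uL)"
    using strict_mono_on_imp_inj_on[OF energy_of_density_strict_mono[OF adm]] pos
    by (auto simp: inj_on_def)
  with False show ?thesis
    using adiabatic_exponent_pos[OF adm] enthalpy_jump[OF adm pos]
    by (simp add: gamma_mean_def jump_def internal_energy_def pressure_def)
qed (simp add: jump_def internal_energy_def pressure_def)

lemma flux_EC_conservative:
  "jump (entropy_vars E) uL uR \<bullet> flux_EC E uL uR = jump (\<lambda>u. pressure E u * velocity u $ 1) uL uR"
proof -
  define g h where "g = gamma_mean E uL uR" and
    "h = (\<lambda>u. internal_energy E u + pressure E u / mass_density u)"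
  define m where "m = mean velocity uL uR $ 1"
  \<comment> \<open>Half the jump of \<open>x\<^sup>2\<close> is the mean of \<open>x\<close> times
    its jump. Applied to each velocity component, this cancels the kinetic part of the first entropy
    variable against the momentum terms.\<close>
  have "jump (entropy_vars E) uL uR \<bullet> flux_EC E uL uR
      = (g * jump h uL uR) * m
        + (velocity uR $ 1 - velocity uL $ 1) * mean (pressure E) uL uR"
    by (simp add: jump_def mean_def entropy_vars_def flux_EC_def Let_def inner_vec_def sum_4
        vector_4 norm_sq_3 h_def m_def flip: g_def)
      (simp add: algebra_simps add_divide_distrib diff_divide_distrib power2_eq_square)
  also have "\<dots> = jump (pressure E) uL uR * m
        + (velocity uR $ 1 - velocity uL $ 1) * mean (pressure E) uL uR"
    unfolding g_def h_def gamma_mean_enthalpy_jump ..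
  \<comment> \<open>Discrete product rule: each factor's jump is weighted by the mean of the
    other.\<close>
  also have "\<dots> = jump (\<lambda>u. pressure E u * velocity u $ 1) uL uR"
    by (simp add: jump_def mean_def m_def field_simps)
  finally show ?thesis .
qed

end

lemma diag_mult_vec: "(diag d *v x) $ i = d $ i * x $ i"
  by (simp add: diag_def matrix_vector_mult_def if_distrib[of "\<lambda>c. c * _"] cong: if_cong)

text \<open>In the variable \<open>y = transpose R *v x\<close> the form is a sum of squares with
  weights \<open>a $ i * b $ i\<close>.\<close>

lemma diag_congruence_nonneg:
  fixes R :: "real ^ 'n ^ 'm"
  assumes "\<And>i. a $ i \<ge> 0" "\<And>i. b $ i \<ge> 0"
  shows "x \<bullet> ((R ** diag a ** diag b ** transpose R) *v x) \<ge> 0"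
proof -
  define y where "y = transpose R *v x"
  have "x \<bullet> ((R ** diag a ** diag b ** transpose R) *v x) = y \<bullet> (diag a *v (diag b *v y))"
    by (simp add: y_def dot_lmul_matrix flip: matrix_vector_mul_assoc)
  also have "\<dots> = (\<Sum>i\<in>UNIV. a $ i * b $ i * (y $ i)\<^sup>2)"
    by (simp add: inner_vec_def diag_mult_vec power2_eq_square algebra_simps)
  also have "\<dots> \<ge> 0"
    using assms by (simp add: sum_nonneg)
  finally show ?thesis .
qed

lemma flux_ES_dissipative:
  assumes "admissible E" "mass_density uL > 0" "mass_density uR > 0"
  shows "jump (entropy_vars E) uL uR \<bullet> flux_ES E uL uR
       \<le> jump (entropy_vars E) uL uR \<bullet> flux_EC E uL uR"
proof -
  \<comment> \<open>These are the diagonal entries of \<open>Z_hat\<close>; those of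
    \<open>abs_Lambda_hat\<close> are absolute values.\<close>
  have "0 \<le> (vector [\<rho> / (2 * a), \<rho>, \<rho>, \<rho> / (2 * a)] :: real ^ 4) $ i"
    if "\<rho> > 0" "a > 0" for \<rho> a i
    using that exhaust_4[of i] by (auto simp: vector_4)
  then have "0 \<le> jump (entropy_vars E) uL uR \<bullet>
      ((R_hat E uL uR ** abs_Lambda_hat E uL uR ** Z_hat E uL uR ** transpose (R_hat E uL uR))
        *v jump (entropy_vars E) uL uR)"
    unfolding abs_Lambda_hat_def Z_hat_def Let_def
    by (intro diag_congruence_nonneg)
      (simp_all add: gamma_mean_pos[OF assms] mean_sound_speed_sq_pos[OF assms])
  then show ?thesis
    by (simp add: flux_ES_def inner_diff_right)
qed

theorem theorem2:
  fixes E :: eos and uL uR :: "real \<Rightarrow> state" and dx t :: real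
  assumes "admissible E"
    and "dx > 0"
    and "mass_density (uL t) > 0" and "mass_density (uR t) > 0"
    and "(uL has_vector_derivative
            (1 / dx) *\<^sub>R (flux E (uL t) - flux_ES E (uL t) (uR t))) (at t)"
    and "(uR has_vector_derivative
            (1 / dx) *\<^sub>R (flux_ES E (uL t) (uR t) - flux E (uR t))) (at t)"
  shows "\<exists>S'. ((\<lambda>\<tau>. entropy E (uL \<tau>) + entropy E (uR \<tau>)) has_real_derivative S') (at t) \<and>
           dx * S' = jump (entropy_vars E) (uL t) (uR t) \<bullet> flux_ES E (uL t) (uR t)
                     - jump (\<lambda>u. entropy_vars E u \<bullet> flux E u) (uL t) (uR t) \<and>
           dx * S' + jump (entropy_flux E) (uL t) (uR t) \<le> 0"
proof -
  \<comment> \<open>This is \<open>s_t = w \<bullet> u_t\<close>, as \<open>w\<close> is the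
    gradient of \<open>s\<close>.\<close>
  have chain: "((\<lambda>\<tau>. entropy E (u \<tau>)) has_real_derivative entropy_vars E (u t) \<bullet> d) (at t)"
    if "mass_density (u t) > 0" "(u has_vector_derivative d) (at t)" for u d
    using has_derivative_compose[OF that(2)[unfolded has_vector_derivative_def]
        entropy_gradient[OF assms(1) that(1)]]
    by (simp add: has_field_derivative_def mult.commute[of _ "entropy_vars E (u t) \<bullet> d"])
  define S' where "S' =
      entropy_vars E (uL t) \<bullet> ((1 / dx) *\<^sub>R (flux E (uL t) - flux_ES E (uL t) (uR t)))
    + entropy_vars E (uR t) \<bullet> ((1 / dx) *\<^sub>R (flux_ES E (uL t) (uR t) - flux E (uR t)))"
  have "((\<lambda>\<tau>. entropy E (uL \<tau>) + entropy E (uR \<tau>)) has_real_derivative S') (at t)"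
    unfolding S'_def by (intro DERIV_add chain assms)
  moreover have update: "dx * S' = jump (entropy_vars E) (uL t) (uR t) \<bullet> flux_ES E (uL t) (uR t)
      - jump (\<lambda>u. entropy_vars E u \<bullet> flux E u) (uL t) (uR t)"
    using assms(2) by (simp add: S'_def jump_def inner_diff_left inner_diff_right field_simps)
  \<comment> \<open>With the baseline flux the left side would be exactly 0, since the jump of
    \<open>w \<bullet> f\<close> minus that of the entropy flux is the jump of
    \<open>p v_1\<close>.\<close>
  moreover have "dx * S' + jump (entropy_flux E) (uL t) (uR t) \<le> 0"
    using flux_ES_dissipative[OF assms(1,3,4)] flux_EC_conservative[OF assms(1,3,4)]
      flux_potential[OF assms(3), of E] flux_potential[OF assms(4), of E]
    unfolding update by (simp add: jump_def)
  ultimately show ?thesis by blast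
qed

end
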